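(* Consider any execution of the Heterogeneous Paxos protocol. For every learner $a$ and every set of messages $q_a$: if $\mathrm{Decision}_a(q_a)$, then there exists a message $x$ of type $1a$ such that $\mathrm{V}(x)=\mathrm{V}(q_a)$ (that is, every value decided by a learner was proposed).
   Context: Setting. There are fixed finite sets of acceptors, proposers (including the acceptors) and learners. Each learner $a$ has a set $Q_a$ of quorums; a quorum is a nonempty set of acceptors, and $Q_a$ is closed under supersets. Messages. Each message $x$ has an unforgeable signer $\mathrm{Sig}(x)$ (an acceptor or proposer), a finite set $x.\mathit{refs}$ of referenced messages (references are by collision-resistant hash, so the reference graph is acyclic), and a type $1a$, $1b$ or $2a$. A $1a$ message $y$ carries a value $y.\mathit{value}$ and a natural number $y.\mathit{ballot}$; a $2a$ message $x$ carries a learner $x.\mathit{lrn}$. Distinct $1a$ messages have distinct ballots. A $1a$ message is a proposal of its value. Definitions. For a set $X$ of messages, $\mathrm{Sig}(X)=\{\mathrm{Sig}(m): m\in X\}$. $\mathrm{Tran}(x)=\{x\}\cup\bigcup_{m\in x.\mathit{refs}}\mathrm{Tran}(m)$. $\mathrm{Get1a}(x)$ is the $1a$ message in $\mathrm{Tran}(x)$ with the largest ballot (every message considered has at least one $1a$ in its $\mathrm{Tran}$). $\mathrm{b}(x)=\mathrm{Get1a}(x).\mathit{ballot}$ and $\mathrm{V}(x)=\mathrm{Get1a}(x).\mathit{value}$. $\mathrm{Decision}_a(q_a)$ holds iff $\mathrm{Sig}(q_a)\in Q_a$ and every $x\in q_a$ is of type $2a$ with $x.\mathit{lrn}=a$,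 and $\mathrm{b}(x)=\mathrm{b}(y)$ for all $x,y\in q_a$. In that case $\mathrm{V}(q_a)$ denotes the common value $\mathrm{V}(m)$ of the messages $m\in q_a$. A learner $a$ decides $\mathrm{V}(q_a)$ when it has received a set $q_a$ of messages with $\mathrm{Decision}_a(q_a)$. *)

theory Defs
  imports Main "HOL-Library.FSet"
begin

datatype ('l, 'v) payload =
    Payload1a (payload_value: 'v) (payload_ballot: nat)
  | Payload1b
  | Payload2a (payload_lrn: 'l)

text \<open>
  A reference is a collision-resistant hash, so it determines the referenced message, and a
  message is determined by its contents. Messages are therefore finitely branching trees. This
  makes the reference graph acyclic (indeed well-founded) and licenses the recursive definition
  of \<open>tran\<close>.
\<close>

datatype ('p, 'l, 'v) message =
  Message (sig: 'p) (refs: "('p, 'l, 'v) message fset") (payload: "('l, 'v) payload")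

definition is_1a :: "('p, 'l, 'v) message \<Rightarrow> bool" where
  "is_1a m \<longleftrightarrow> is_Payload1a (payload m)"

definition is_2a :: "('p, 'l, 'v) message \<Rightarrow> bool" where
  "is_2a m \<longleftrightarrow> is_Payload2a (payload m)"

text \<open>
  The next two functions are meaningful only on 1a messages, the third only on 2a messages.
\<close>

definition msg_value :: "('p, 'l, 'v) message \<Rightarrow> 'v" where
  "msg_value m = payload_value (payload m)"

definition msg_ballot :: "('p, 'l, 'v) message \<Rightarrow> nat" where
  "msg_ballot m = payload_ballot (payload m)"

definition msg_lrn :: "('p, 'l, 'v) message \<Rightarrow> 'l" where
  "msg_lrn m = payload_lrn (payload m)"

primrec tran :: "('p, 'l, 'v) message \<Rightarrow> ('p, 'l, 'v) message set" where
  "tran (Message s R k) = insert (Message s R k) (\<Union> (fset (tran |`| R)))"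

lemma tran_eq: "tran x = {x} \<union> (\<Union>m \<in> fset (refs x). tran m)"
  by (cases x) simp

definition get1a :: "('p, 'l, 'v) message \<Rightarrow> ('p, 'l, 'v) message" where
  "get1a x = (ARG_MAX msg_ballot m. m \<in> tran x \<and> is_1a m)"

definition b :: "('p, 'l, 'v) message \<Rightarrow> nat" where
  "b x = msg_ballot (get1a x)"

definition V :: "('p, 'l, 'v) message \<Rightarrow> 'v" where
  "V x = msg_value (get1a x)"

definition decision ::
  "('l \<Rightarrow> 'p set set) \<Rightarrow> 'l \<Rightarrow> ('p, 'l, 'v) message set \<Rightarrow> bool" where
  "decision Q a q \<longleftrightarrow>
     sig ` q \<in> Q a \<and>
     (\<forall>x\<in>q. is_2a x \<and> msg_lrn x = a) \<and>
     (\<forall>x\<in>q. \<forall>y\<in>q. b x = b y)"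

definition V_set :: "('p, 'l, 'v) message set \<Rightarrow> 'v" where
  "V_set q = (THE v. \<forall>m\<in>q. V m = v)"

text \<open>
  An execution is represented by its set \<open>M\<close> of messages. No behaviour is prescribed for the
  participants, so every message history of the protocol, with arbitrarily faulty participants,
  is an instance.
\<close>

locale hpaxos_execution =
  fixes acceptors :: "'p set"
    and proposers :: "'p set"
    and learners :: "'l set"
    and Q :: "'l \<Rightarrow> 'p set set"
    and M :: "('p, 'l, 'v) message set"
  assumes finite_acceptors: "finite acceptors"
    and finite_proposers: "finite proposers"
    and finite_learners: "finite learners"
    and acceptors_proposers: "acceptors \<subseteq> proposers"
    and quorum_nonempty: "\<lbrakk>a \<in> learners; q \<in> Q a\<rbrakk> \<Longrightarrow> q \<noteq> {}"
    and quorum_acceptors: "\<lbrakk>a \<in> learners; q \<in> Q a\<rbrakk> \<Longrightarrow> q \<subseteq> acceptors"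
    and quorum_superset:
      "\<lbrakk>a \<in> learners; q \<in> Q a; q \<subseteq> q'; q' \<subseteq> acceptors\<rbrakk> \<Longrightarrow> q' \<in> Q a"
    and sig_proposer: "m \<in> M \<Longrightarrow> sig m \<in> proposers"
    and lrn_learner: "\<lbrakk>m \<in> M; is_2a m\<rbrakk> \<Longrightarrow> msg_lrn m \<in> learners"
    and refs_closed: "m \<in> M \<Longrightarrow> fset (refs m) \<subseteq> M"
    and ballot_inj: "inj_on msg_ballot {m \<in> M. is_1a m}"
    and tran_1a: "m \<in> M \<Longrightarrow> \<exists>y\<in>tran m. is_1a y"

end

theory Submission
  imports Defs
begin

text \<open>
  The map \<open>get1a\<close> is idempotent: \<open>get1a m\<close> carries the largest ballot in \<open>tran m\<close>, hence also in
  the smaller set \<open>tran (get1a m)\<close>, and ballots identify 1a messages. So \<open>get1a m\<close>, for any \<open>m\<close>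
  in the nonempty set \<open>q\<close>, is a proposal of \<open>V m\<close>. As all members of \<open>q\<close> have the same ballot,
  they also share the same \<open>get1a\<close>, which makes \<open>V_set q\<close> well defined.
\<close>

lemma tran_refl: "x \<in> tran x"
  by (subst tran_eq) simp

lemma finite_tran: "finite (tran x)"
  by (induction x) auto

lemma tran_trans: "y \<in> tran x \<Longrightarrow> tran y \<subseteq> tran x"
proof (induction x)
  case (Message s R k)
  show ?case
  proof (cases "y = Message s R k")
    case False
    then obtain m where "m \<in> fset R" "y \<in> tran m"
      using Message.prems by auto
    then show ?thesis
      using Message.IH by fastforce
  qed simp
qed

lemma get1a_arg_max:
  assumes "\<exists>y\<in>tran x. is_1a y"
  shows get1a_in_tran: "get1a x \<in> tran x"
    and is_1a_get1a: "is_1a (get1a x)"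
    and msg_ballot_le_get1a:
      "\<lbrakk>y \<in> tran x; is_1a y\<rbrakk> \<Longrightarrow> msg_ballot y \<le> msg_ballot (get1a x)"
proof -
  let ?P = "\<lambda>m. m \<in> tran x \<and> is_1a m"
  obtain z where z: "?P z"
    using assms by blast
  \<comment> \<open>The arg max rules for \<open>nat\<close> ask for a strict upper bound;
    finiteness of \<open>tran x\<close> supplies the maximum, and \<open>Suc\<close> makes the bound
    strict.\<close>
  have bounded: "\<forall>y. ?P y \<longrightarrow> msg_ballot y < Suc (Max (msg_ballot ` tran x))"
    by (simp add: finite_tran less_Suc_eq_le)
  have "?P (get1a x)"
    unfolding get1a_def by (rule arg_max_natI[OF z bounded])
  then show "get1a x \<in> tran x" "is_1a (get1a x)"
    by simp_all
  show "msg_ballot y \<le> msg_ballot (get1a x)" if "y \<in> tran x" "is_1a y"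
    unfolding get1a_def using that bounded by (intro arg_max_nat_le) auto
qed

context hpaxos_execution
begin

lemma tran_subset: "m \<in> M \<Longrightarrow> tran m \<subseteq> M"
proof (induction m)
  case (Message s R k)
  then show ?case
    using refs_closed[OF Message.prems] by fastforce
qed

lemma get1a_in_messages: "m \<in> M \<Longrightarrow> get1a m \<in> M"
  using tran_subset get1a_in_tran tran_1a by blast

text \<open>Both \<open>get1a x\<close> and \<open>get1a y\<close> are 1a messages of
  \<open>M\<close>, where \<open>ballot_inj\<close> lets a ballot determine its message.\<close>

lemma get1a_eq_iff_b_eq:
  assumes "x \<in> M" "y \<in> M"
  shows "get1a x = get1a y \<longleftrightarrow> b x = b y"
  using assms ballot_inj
  by (auto simp: b_def get1a_in_messages is_1a_get1a tran_1a dest: inj_onD)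

lemma get1a_idem:
  assumes m: "m \<in> M"
  shows "get1a (get1a m) = get1a m"
proof -
  let ?x = "get1a m"
  have x: "?x \<in> M" "?x \<in> tran m" "is_1a ?x"
    using m by (simp_all add: get1a_in_messages get1a_in_tran is_1a_get1a tran_1a)
  have "get1a ?x \<in> tran m"
    using x tran_trans get1a_in_tran tran_1a by blast
  then have "msg_ballot (get1a ?x) \<le> msg_ballot ?x"
    using m x by (simp add: msg_ballot_le_get1a is_1a_get1a tran_1a)
  \<comment> \<open>Conversely, \<open>?x\<close> is itself a 1a candidate in
    \<open>tran ?x\<close>; the equal ballots then identify the two messages.\<close>
  moreover have "msg_ballot ?x \<le> msg_ballot (get1a ?x)"
    using x by (simp add: msg_ballot_le_get1a tran_1a tran_refl)
  ultimately show ?thesis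
    using x ballot_inj by (auto simp: get1a_in_messages is_1a_get1a tran_1a dest: inj_onD)
qed

lemma V_set_eq:
  assumes "decision Q a q" "q \<subseteq> M" "m \<in> q"
  shows "V_set q = V m"
proof -
  have V_eq: "V x = V m" if "x \<in> q" for x
  proof -
    have "b x = b m"
      using assms that unfolding decision_def by blast
    then have "get1a x = get1a m"
      using assms that by (subst get1a_eq_iff_b_eq) auto
    then show ?thesis
      by (simp add: V_def)
  qed
  show ?thesis
    unfolding V_set_def
  proof (rule the_equality)
    show "\<forall>x\<in>q. V x = V m"
      using V_eq by blast
    \<comment> \<open>The member \<open>m\<close> pins down \<open>v\<close>; over an empty
      \<open>q\<close> every \<open>v\<close> would qualify.\<close>
    show "v = V m" if "\<forall>x\<in>q. V x = v" for v
      using that assms(3) by simp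
  qed
qed

end

theorem theorem39:
  fixes acceptors proposers :: "'p set"
    and learners :: "'l set"
    and Q :: "'l \<Rightarrow> 'p set set"
    and M :: "('p, 'l, 'v) message set"
    and a :: 'l
    and q :: "('p, 'l, 'v) message set"
  assumes "hpaxos_execution acceptors proposers learners Q M"
    and "a \<in> learners"
    and "q \<subseteq> M"
    and "decision Q a q"
  shows "\<exists>x\<in>M. is_1a x \<and> V x = V_set q"
proof -
  interpret hpaxos_execution acceptors proposers learners Q M
    by fact
  \<comment> \<open>The signers form a quorum of the learner \<open>a\<close>, so \<open>q\<close>
    cannot be empty.\<close>
  have "sig ` q \<noteq> {}"
    using assms(2,4) quorum_nonempty unfolding decision_def by blast
  then obtain m where m: "m \<in> q" "m \<in> M"
    using assms by auto
  have "V (get1a m) = V m"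
    by (simp add: V_def get1a_idem m)
  also have "\<dots> = V_set q"
    using assms m by (simp add: V_set_eq)
  finally show ?thesis
    using m get1a_in_messages is_1a_get1a tran_1a by blast
qed

end
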